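(* Let $T$ be an infinite rooted tree, let $\psi:T\to\mathbb{C}$ be a function and let $0<p<q<\infty$. Then the following are equivalent: (a) The multiplication operator $M_\psi:\mathbb{T}_p\to\mathbb{T}_q$ is bounded. (b) The multiplication operator $M_\psi:\mathbb{T}_{p,0}\to\mathbb{T}_{q,0}$ is bounded. (c) $\sup_{n\in\mathbb{N}_0}\left\{c_n^{\frac1p-\frac1q}M_\infty(n,\psi)\right\}<\infty$. In this case, $\|M_\psi\|=\sup_{n\in\mathbb{N}_0}\left\{c_n^{\frac1p-\frac1q}M_\infty(n,\psi)\right\}$.
   Context: Let $T$ be an infinite rooted tree with root $o$; $T$ also denotes its vertex set. For a vertex $v$, $|v|$ is the number of edges in the unique path from $o$ to $v$. For $n\in\mathbb{N}_0=\{0,1,2,\dots\}$, $D_n=\{v\in T:|v|=n\}$, and $c_n$ is the number of elements of $D_n$, assumed finite for each $n$ (so $1\le c_n<\infty$). For $f:T\to\mathbb{C}$ and $0<p<\infty$ put $M_p(n,f)=\left(\frac1{c_n}\sum_{|v|=n}|f(v)|^p\right)^{1/p}$, and $M_\infty(n,f)=\max_{|v|=n}|f(v)|$. For $0<p\le\infty$ put $\|f\|_p=\sup_{n\in\mathbb{N}_0}M_p(n,f)$, $\mathbb{T}_p=\{f:T\to\mathbb{C}:\|f\|_p<\infty\}$ and $\mathbb{T}_{p,0}=\{f\in\mathbb{T}_p:\lim_{n\to\infty}M_p(n,f)=0\}$ (with the same $\|\cdot\|_p$). For $\psi:T\to\mathbb{C}$, $M_\psi f=\psi f$ (pointwise product).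 $M_\psi:X\to Y$ is bounded if $\psi f\in Y$ for every $f\in X$ and $\|M_\psi\|:=\sup\{\|\psi f\|_Y/\|f\|_X: f\in X, f\neq0\}<\infty$; the norm formula holds for the operator in (a) as well as for the one in (b). *)

theory Defs
  imports Complex_Main "HOL-Library.Extended_Nonnegative_Real" "Graph_Theory.Pair_Digraph"
begin

text \<open>
  A simple undirected graph, possibly infinite, is a symmetric loop-free digraph whose arcs are
  pairs of vertices. The library predicate \<open>tree\<close> is unsuitable for such graphs, because it
  counts the closed walk \<open>a, b, a\<close> along a single edge as a cycle. A tree is therefore a graph in
  which any two vertices are joined by exactly one path; \<open>apath\<close> is a walk without repeated
  vertices, represented by the list of its arcs.
\<close>

locale rooted_tree = pair_bidirected_digraph T for T :: "'a pair_pre_digraph" +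
  fixes r :: 'a
  assumes root_in_verts: "r \<in> pverts T"
    and unique_path: "\<lbrakk>u \<in> pverts T; v \<in> pverts T\<rbrakk> \<Longrightarrow> \<exists>!w. apath u w v"

definition depth :: "'a pair_pre_digraph \<Rightarrow> 'a \<Rightarrow> 'a \<Rightarrow> nat" where
  "depth T r v = length (THE w. pre_digraph.apath (with_proj T) r w v)"

definition level :: "'a pair_pre_digraph \<Rightarrow> 'a \<Rightarrow> nat \<Rightarrow> 'a set" where
  "level T r n = {v \<in> pverts T. depth T r v = n}"

text \<open>
  Complex functions on the tree are functions on the whole type \<open>'a\<close>, considered only on the
  vertices: none of the notions below depends on values outside \<open>pverts T\<close>.
\<close>

definition mean :: "'a pair_pre_digraph \<Rightarrow> 'a \<Rightarrow> real \<Rightarrow> nat \<Rightarrow> ('a \<Rightarrow> complex) \<Rightarrow> real" where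
  "mean T r p n f =
     (1 / real (card (level T r n)) * (\<Sum>v\<in>level T r n. cmod (f v) powr p)) powr (1 / p)"

definition mean_inf :: "'a pair_pre_digraph \<Rightarrow> 'a \<Rightarrow> nat \<Rightarrow> ('a \<Rightarrow> complex) \<Rightarrow> real" where
  "mean_inf T r n f = Max ((\<lambda>v. cmod (f v)) ` level T r n)"

definition hnorm :: "'a pair_pre_digraph \<Rightarrow> 'a \<Rightarrow> real \<Rightarrow> ('a \<Rightarrow> complex) \<Rightarrow> ennreal" where
  "hnorm T r p f = (SUP n. ennreal (mean T r p n f))"

definition hardy :: "'a pair_pre_digraph \<Rightarrow> 'a \<Rightarrow> real \<Rightarrow> ('a \<Rightarrow> complex) set" where
  "hardy T r p = {f. hnorm T r p f < \<infinity>}"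

definition hardy0 :: "'a pair_pre_digraph \<Rightarrow> 'a \<Rightarrow> real \<Rightarrow> ('a \<Rightarrow> complex) set" where
  "hardy0 T r p = {f \<in> hardy T r p. (\<lambda>n. mean T r p n f) \<longlonglongrightarrow> 0}"

definition mult_op :: "('a \<Rightarrow> complex) \<Rightarrow> ('a \<Rightarrow> complex) \<Rightarrow> 'a \<Rightarrow> complex" where
  "mult_op \<psi> f = (\<lambda>v. \<psi> v * f v)"

text \<open>
  In \<open>op_norm T X N N' A\<close> and \<open>bounded_op T X N Y N' A\<close>, the domain \<open>X\<close> carries
  the norm \<open>N\<close> and the codomain \<open>Y\<close> the norm \<open>N'\<close>. The condition on \<open>f\<close> in
  \<open>op_norm\<close> says that \<open>f\<close> is not the zero function on the tree.
\<close>

definition op_norm :: "'a pair_pre_digraph \<Rightarrow> ('a \<Rightarrow> complex) set \<Rightarrow>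
    (('a \<Rightarrow> complex) \<Rightarrow> ennreal) \<Rightarrow> (('a \<Rightarrow> complex) \<Rightarrow> ennreal) \<Rightarrow>
    (('a \<Rightarrow> complex) \<Rightarrow> 'a \<Rightarrow> complex) \<Rightarrow> ennreal" where
  "op_norm T X N N' A = (SUP f\<in>{f \<in> X. \<exists>v\<in>pverts T. f v \<noteq> 0}. N' (A f) / N f)"

definition bounded_op :: "'a pair_pre_digraph \<Rightarrow> ('a \<Rightarrow> complex) set \<Rightarrow>
    (('a \<Rightarrow> complex) \<Rightarrow> ennreal) \<Rightarrow> ('a \<Rightarrow> complex) set \<Rightarrow>
    (('a \<Rightarrow> complex) \<Rightarrow> ennreal) \<Rightarrow> (('a \<Rightarrow> complex) \<Rightarrow> 'a \<Rightarrow> complex) \<Rightarrow> bool" where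
  "bounded_op T X N Y N' A \<longleftrightarrow> (\<forall>f\<in>X. A f \<in> Y) \<and> op_norm T X N N' A < \<infinity>"

end

theory Submission
  imports Defs
begin

text \<open>
  On a level with \<open>c\<close> vertices, the inclusion of \<open>\<ell>\<^sup>p\<close> into \<open>\<ell>\<^sup>q\<close> is a contraction, and
  normalising the sums contributes the factor \<open>c\<close> to the power \<open>1/p - 1/q\<close>; hence
  \<open>M\<^sub>q(n, \<psi> f) \<le> s\<^sub>n M\<^sub>p(n, f)\<close> with \<open>s\<^sub>n\<close> the \<open>n\<close>-th term of the supremum. Equality holds for the
  indicator of a vertex of level \<open>n\<close> at which \<open>|\<psi>|\<close> is maximal. That indicator lies in both
  domains, so both operator norms equal the supremum, whether or not it is finite.
\<close>

section \<open>Levels of the tree are nonempty\<close>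

lemma (in rooted_tree) depth_eqI:
  assumes "apath r w v"
  shows "depth T r v = length w"
proof -
  have "v \<in> pverts T"
    using assms by (auto simp: apath_def)
  then have "\<exists>!w. apath r w v"
    using unique_path root_in_verts by blast
  then have "(THE w. apath r w v) = w"
    using assms by (rule the1_equality)
  then show ?thesis
    by (simp add: depth_def)
qed

text \<open>Cutting the path from the root to \<open>v\<close> after \<open>n\<close> arcs leaves a
  path, and its endpoint has depth \<open>n\<close>.\<close>

lemma (in rooted_tree) level_of_lesser_depth:
  assumes "v \<in> pverts T" "n \<le> depth T r v"
  shows "level T r n \<noteq> {}"
proof -
  obtain w where w: "apath r w v"
    using unique_path[OF root_in_verts assms(1)] by (elim ex1E)
  define u where "u = last (pawalk_verts r (take n w))"
  have "apath r (take n w @ drop n w) v"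
    using w by simp
  then have u: "apath r (take n w) u"
    unfolding u_def by (rule iffD1[OF apath_append_iff, THEN conjunct1])
  have "u \<in> pverts T"
    using u by (auto simp: apath_def)
  moreover have "depth T r u = n"
    using depth_eqI[OF u] depth_eqI[OF w] assms(2) by simp
  ultimately show ?thesis
    by (auto simp: level_def)
qed

text \<open>An empty level \<open>n\<close> would bound all depths by \<open>n\<close>, so the tree
  would be a finite union of finite levels. Nonemptiness makes the maximum in
  \<open>mean_inf\<close> and the division by the level size meaningful.\<close>

lemma (in rooted_tree) level_nonempty:
  assumes "infinite (pverts T)" "\<And>n. finite (level T r n)"
  shows "level T r n \<noteq> {}"
proof (rule ccontr)
  assume "\<not> level T r n \<noteq> {}"
  then have "depth T r v < n" if "v \<in> pverts T" for v
    using level_of_lesser_depth[OF that, of n] by fastforce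
  then have "pverts T \<subseteq> (\<Union>m<n. level T r m)"
    by (auto simp: level_def)
  then show False
    using assms by (meson finite_UN_I finite_lessThan finite_subset)
qed

section \<open>Power sums and means on one level\<close>

lemma powr_sum_powr_le:
  fixes x :: "'b \<Rightarrow> real"
  assumes A: "finite A" and nonneg: "\<And>i. i \<in> A \<Longrightarrow> 0 \<le> x i" and p: "0 < p" and q: "p < q"
  shows "(\<Sum>i\<in>A. x i powr q) powr (1 / q) \<le> (\<Sum>i\<in>A. x i powr p) powr (1 / p)"
proof -
  define P where "P = (\<Sum>i\<in>A. x i powr p)"
  have P0: "0 \<le> P"
    unfolding P_def by (intro sum_nonneg) simp
  have le: "x i \<le> P powr (1 / p)" if "i \<in> A" for i
  proof -
    have "x i powr p \<le> P"
      unfolding P_def using A that by (intro member_le_sum) auto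
    then have "(x i powr p) powr (1 / p) \<le> P powr (1 / p)"
      using p by (intro powr_mono2) auto
    then show ?thesis
      using p nonneg[OF that] by (simp add: powr_powr)
  qed
  \<comment> \<open>Only the factor with exponent \<open>q - p\<close> is estimated, by the bound
    \<open>le\<close>; the remaining factors sum to \<open>P\<close>. Since nothing is divided by
    \<open>P\<close>, the case \<open>P = 0\<close> needs no separate argument.\<close>
  have "(\<Sum>i\<in>A. x i powr q) = (\<Sum>i\<in>A. x i powr p * x i powr (q - p))"
    by (simp flip: powr_add)
  also have "\<dots> \<le> (\<Sum>i\<in>A. x i powr p * (P powr (1 / p)) powr (q - p))"
    using le nonneg q by (intro sum_mono mult_left_mono powr_mono2) auto
  also have "\<dots> = P * P powr ((q - p) / p)"
    by (simp add: P_def powr_powr flip: sum_distrib_right)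
  also have "\<dots> = P powr (q / p)"
    using P0 p powr_add[of P 1 "(q - p) / p"] by (simp add: diff_divide_distrib)
  finally have "(\<Sum>i\<in>A. x i powr q) powr (1 / q) \<le> (P powr (q / p)) powr (1 / q)"
    using p q by (intro powr_mono2 sum_nonneg) auto
  also have "\<dots> = P powr (1 / p)"
    using p q by (simp add: powr_powr)
  finally show ?thesis
    by (simp add: P_def)
qed

lemma mean_eq:
  "mean T r p n f =
     real (card (level T r n)) powr (- 1 / p) * (\<Sum>v\<in>level T r n. cmod (f v) powr p) powr (1 / p)"
proof -
  have "mean T r p n f = (1 / real (card (level T r n))) powr (1 / p) *
      (\<Sum>v\<in>level T r n. cmod (f v) powr p) powr (1 / p)"
    unfolding mean_def by (rule powr_mult)
  then show ?thesis
    by (simp add: powr_divide powr_minus_divide)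
qed

lemma mean_nonneg: "0 \<le> mean T r p n f"
  by (simp add: mean_def)

section \<open>Upper bound for the operator norm, on finite nonempty levels\<close>

locale finite_levels =
  fixes T :: "'a pair_pre_digraph" and r :: 'a
  assumes finite_level: "\<And>n. finite (level T r n)"
    and level_not_empty: "\<And>n. level T r n \<noteq> {}"
begin

lemma card_level_pos: "0 < card (level T r n)"
  by (simp add: card_gt_0_iff finite_level level_not_empty)

lemma cmod_le_mean_inf: "v \<in> level T r n \<Longrightarrow> cmod (\<psi> v) \<le> mean_inf T r n \<psi>"
  unfolding mean_inf_def using finite_level by (intro Max_ge) auto

lemma mean_inf_nonneg: "0 \<le> mean_inf T r n \<psi>"
  using level_not_empty[of n] cmod_le_mean_inf norm_ge_zero order_trans by (metis ex_in_conv)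

lemma mean_mult_op_le:
  assumes p: "0 < p" and q: "p < q"
  shows "mean T r q n (mult_op \<psi> f) \<le>
    real (card (level T r n)) powr (1 / p - 1 / q) * mean_inf T r n \<psi> * mean T r p n f"
proof -
  let ?L = "level T r n" and ?M = "mean_inf T r n \<psi>"
  let ?c = "real (card ?L)"
  have "(\<Sum>v\<in>?L. cmod (mult_op \<psi> f v) powr q) \<le> (\<Sum>v\<in>?L. ?M powr q * cmod (f v) powr q)"
    using p q mean_inf_nonneg cmod_le_mean_inf
    by (intro sum_mono) (auto simp: mult_op_def norm_mult powr_mult intro!: mult_right_mono powr_mono2)
  also have "\<dots> = ?M powr q * (\<Sum>v\<in>?L. cmod (f v) powr q)"
    by (simp add: sum_distrib_left)
  finally have "(\<Sum>v\<in>?L. cmod (mult_op \<psi> f v) powr q) powr (1 / q) \<le>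
      (?M powr q * (\<Sum>v\<in>?L. cmod (f v) powr q)) powr (1 / q)"
    using p q by (intro powr_mono2 sum_nonneg) auto
  also have "\<dots> = ?M * (\<Sum>v\<in>?L. cmod (f v) powr q) powr (1 / q)"
    using p q mean_inf_nonneg by (simp add: powr_mult powr_powr sum_nonneg)
  also have "\<dots> \<le> ?M * (\<Sum>v\<in>?L. cmod (f v) powr p) powr (1 / p)"
    using p q finite_level mean_inf_nonneg by (intro mult_left_mono powr_sum_powr_le) auto
  finally have "mean T r q n (mult_op \<psi> f) \<le>
      ?c powr (- 1 / q) * (?M * (\<Sum>v\<in>?L. cmod (f v) powr p) powr (1 / p))"
    unfolding mean_eq by (intro mult_left_mono) auto
  \<comment> \<open>The weight arises here: the sum with exponent \<open>p\<close> needs the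
    normalisation \<open>- 1 / p\<close>, and the rest of the exponent is left over.\<close>
  also have "?c powr (- 1 / q) = ?c powr (1 / p - 1 / q) * ?c powr (- 1 / p)"
    by (simp flip: powr_add)
  finally show ?thesis
    unfolding mean_eq by (simp add: mult_ac)
qed

text \<open>The level estimates are combined in \<open>ennreal\<close>, so the supremum may be
  infinite.\<close>

lemma hnorm_mult_op_le:
  assumes p: "0 < p" and q: "p < q"
  shows "hnorm T r q (mult_op \<psi> f) \<le>
    (SUP n. ennreal (real (card (level T r n)) powr (1 / p - 1 / q) * mean_inf T r n \<psi>)) *
    hnorm T r p f"
    (is "_ \<le> ?S * _")
  unfolding hnorm_def[of T r q]
proof (rule SUP_least)
  fix n
  let ?s = "real (card (level T r n)) powr (1 / p - 1 / q) * mean_inf T r n \<psi>"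
  have "ennreal (mean T r q n (mult_op \<psi> f)) \<le> ennreal (?s * mean T r p n f)"
    using mean_mult_op_le[OF p q] by (rule ennreal_leI)
  also have "\<dots> = ennreal ?s * ennreal (mean T r p n f)"
    by (simp add: ennreal_mult mean_nonneg mean_inf_nonneg)
  also have "\<dots> \<le> ?S * hnorm T r p f"
    unfolding hnorm_def by (intro mult_mono SUP_upper) auto
  finally show "ennreal (mean T r q n (mult_op \<psi> f)) \<le> ?S * hnorm T r p f" .
qed

lemma hnorm_nonzero:
  assumes "v \<in> pverts T" "f v \<noteq> 0"
  shows "hnorm T r p f \<noteq> 0"
proof -
  define n where "n = depth T r v"
  have "v \<in> level T r n"
    using assms by (simp add: level_def n_def)
  then have "0 < (\<Sum>v\<in>level T r n. cmod (f v) powr p)"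
    using assms(2) finite_level by (intro sum_pos2[of _ v]) auto
  then have "0 < mean T r p n f"
    using card_level_pos[of n] by (simp add: mean_def)
  then have "0 < ennreal (mean T r p n f)"
    by simp
  also have "\<dots> \<le> hnorm T r p f"
    unfolding hnorm_def by (rule SUP_upper) simp
  finally show ?thesis
    by simp
qed

lemma op_norm_mult_op_le:
  assumes "X \<subseteq> hardy T r p" "0 < p" "p < q"
  shows "op_norm T X (hnorm T r p) (hnorm T r q) (mult_op \<psi>) \<le>
    (SUP n. ennreal (real (card (level T r n)) powr (1 / p - 1 / q) * mean_inf T r n \<psi>))"
    (is "_ \<le> ?S")
  unfolding op_norm_def
proof (rule SUP_least)
  fix f
  assume "f \<in> {f \<in> X. \<exists>v\<in>pverts T. f v \<noteq> 0}"
  \<comment> \<open>Cancelling a factor in \<open>ennreal\<close> requires it to be neither zero nor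
    infinite.\<close>
  then have ne: "hnorm T r p f \<noteq> 0" "hnorm T r p f \<noteq> top"
    using assms(1) by (auto simp: hnorm_nonzero hardy_def)
  have "hnorm T r q (mult_op \<psi> f) / hnorm T r p f \<le> ?S * hnorm T r p f / hnorm T r p f"
    using assms by (intro divide_right_mono_ennreal hnorm_mult_op_le)
  also have "\<dots> = ?S"
    using ne by (simp add: mult_divide_eq_ennreal)
  finally show "hnorm T r q (mult_op \<psi> f) / hnorm T r p f \<le> ?S" .
qed

section \<open>Indicators of single vertices and the lower bound\<close>

lemma mean_single:
  assumes "v \<in> level T r n" "0 < p"
  shows "mean T r p m (\<lambda>u. if u = v then z else 0) =
    (if m = n then real (card (level T r n)) powr (- 1 / p) * cmod z else 0)"
proof -
  have "v \<in> level T r m \<longleftrightarrow> m = n"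
    using assms(1) by (auto simp: level_def)
  moreover have "cmod (if u = v then z else 0) powr p = (if u = v then cmod z powr p else 0)" for u
    by simp
  ultimately show ?thesis
    using assms(2) finite_level by (simp add: mean_eq powr_powr)
qed

lemma hnorm_single:
  assumes "v \<in> level T r n" "0 < p"
  shows "hnorm T r p (\<lambda>u. if u = v then z else 0) =
    ennreal (real (card (level T r n)) powr (- 1 / p) * cmod z)"
  unfolding hnorm_def mean_single[OF assms]
  by (intro antisym SUP_least SUP_upper2[of n]) auto

lemma single_in_hardy0:
  assumes "v \<in> level T r n" "0 < p"
  shows "(\<lambda>u. if u = v then z else 0) \<in> hardy0 T r p"
proof -
  have "eventually (\<lambda>m. mean T r p m (\<lambda>u. if u = v then z else 0) = 0) sequentially"
    using eventually_gt_at_top[of n] by eventually_elim (simp add: mean_single[OF assms])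
  then show ?thesis
    by (simp add: hardy0_def hardy_def hnorm_single[OF assms] tendsto_eventually)
qed

lemma op_norm_mult_op_ge:
  assumes X: "hardy0 T r p \<subseteq> X" and p: "0 < p" and q: "0 < q"
  shows "(SUP n. ennreal (real (card (level T r n)) powr (1 / p - 1 / q) * mean_inf T r n \<psi>)) \<le>
    op_norm T X (hnorm T r p) (hnorm T r q) (mult_op \<psi>)"
proof (rule SUP_least)
  fix n
  let ?c = "real (card (level T r n))"
  have "mean_inf T r n \<psi> \<in> (\<lambda>v. cmod (\<psi> v)) ` level T r n"
    unfolding mean_inf_def using finite_level level_not_empty by (intro Max_in) auto
  then obtain v where v: "v \<in> level T r n" and M: "mean_inf T r n \<psi> = cmod (\<psi> v)"
    by auto
  define f :: "'a \<Rightarrow> complex" where "f = (\<lambda>u. if u = v then 1 else 0)"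
  have "mult_op \<psi> f = (\<lambda>u. if u = v then \<psi> v else 0)"
    by (auto simp: mult_op_def f_def)
  then have N': "hnorm T r q (mult_op \<psi> f) = ennreal (?c powr (- 1 / q) * cmod (\<psi> v))"
    using hnorm_single[OF v q] by simp
  have N: "hnorm T r p f = ennreal (?c powr (- 1 / p))"
    using hnorm_single[OF v p] by (simp add: f_def)
  have "?c powr (1 / p - 1 / q) = ?c powr (- 1 / q) / ?c powr (- 1 / p)"
    by (simp flip: powr_diff)
  then have "ennreal (?c powr (1 / p - 1 / q) * mean_inf T r n \<psi>) =
      hnorm T r q (mult_op \<psi> f) / hnorm T r p f"
    \<comment> \<open>A positive level size makes the divisor positive, so the quotient in
      \<open>ennreal\<close> agrees with the real one.\<close>
    using card_level_pos[of n] by (simp add: N N' M divide_ennreal)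
  also have "\<dots> \<le> op_norm T X (hnorm T r p) (hnorm T r q) (mult_op \<psi>)"
    unfolding op_norm_def
  proof (rule SUP_upper)
    have "v \<in> pverts T" "f v \<noteq> 0"
      using v by (auto simp: level_def f_def)
    then show "f \<in> {f \<in> X. \<exists>v\<in>pverts T. f v \<noteq> 0}"
      using X single_in_hardy0[OF v p] by (auto simp: f_def)
  qed
  finally show "ennreal (?c powr (1 / p - 1 / q) * mean_inf T r n \<psi>) \<le>
    op_norm T X (hnorm T r p) (hnorm T r q) (mult_op \<psi>)" .
qed

text \<open>The upper bound needs only finite norms in \<open>X\<close>, the lower bound only the
  indicators. Leaving \<open>X\<close> free between the two spaces covers both operators at
  once.\<close>

lemma op_norm_mult_op:
  assumes "hardy0 T r p \<subseteq> X" "X \<subseteq> hardy T r p" "0 < p" "p < q"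
  shows "op_norm T X (hnorm T r p) (hnorm T r q) (mult_op \<psi>) =
    (SUP n. ennreal (real (card (level T r n)) powr (1 / p - 1 / q) * mean_inf T r n \<psi>))"
  using assms by (intro antisym op_norm_mult_op_le op_norm_mult_op_ge) auto

section \<open>Mapping properties and the equivalence\<close>

lemma mult_op_hardy:
  assumes S: "(SUP n. ennreal (real (card (level T r n)) powr (1 / p - 1 / q) * mean_inf T r n \<psi>)) < \<infinity>"
    and "0 < p" "p < q" and f: "f \<in> hardy T r p"
  shows "mult_op \<psi> f \<in> hardy T r q"
proof -
  have "hnorm T r p f < \<infinity>"
    using f by (simp add: hardy_def)
  then show ?thesis
    using hnorm_mult_op_le[OF assms(2,3), of \<psi> f] S
    by (auto simp: hardy_def ennreal_mult_less_top intro: le_less_trans)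
qed

text \<open>A bound on the norms alone would not give decay; the estimate on each level, with a
  constant independent of the level, does.\<close>

lemma mult_op_hardy0:
  assumes S: "(SUP n. ennreal (real (card (level T r n)) powr (1 / p - 1 / q) * mean_inf T r n \<psi>)) < \<infinity>"
      (is "?S < _")
    and p: "0 < p" and q: "p < q" and f: "f \<in> hardy0 T r p"
  shows "mult_op \<psi> f \<in> hardy0 T r q"
proof -
  \<comment> \<open>Finiteness of the supremum turns it into a real constant, as the limit argument
    takes place in the reals.\<close>
  have s_le: "real (card (level T r n)) powr (1 / p - 1 / q) * mean_inf T r n \<psi> \<le> enn2real ?S"
    (is "?s \<le> _") for n
  proof -
    have "ennreal ?s \<le> ?S"
      by (rule SUP_upper) simp
    also have "\<dots> = ennreal (enn2real ?S)"
      using S by simp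
    finally show ?thesis
      by simp
  qed
  have "mean T r q n (mult_op \<psi> f) \<le> enn2real ?S * mean T r p n f" for n
    using mean_mult_op_le[OF p q] mult_right_mono[OF s_le mean_nonneg] by (rule order_trans)
  moreover have "(\<lambda>n. enn2real ?S * mean T r p n f) \<longlonglongrightarrow> 0"
    using f by (auto simp: hardy0_def intro: tendsto_mult_right_zero)
  ultimately have "(\<lambda>n. mean T r q n (mult_op \<psi> f)) \<longlonglongrightarrow> 0"
    by - (rule tendsto_sandwich[OF always_eventually always_eventually tendsto_const],
      auto simp: mean_nonneg)
  then show ?thesis
    using f mult_op_hardy[OF S p q, of f] unfolding hardy0_def by blast
qed

end

theorem theorem4:
  fixes T :: "'a pair_pre_digraph" and r :: 'a and \<psi> :: "'a \<Rightarrow> complex" and p q :: real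
  defines "a \<equiv> bounded_op T (hardy T r p) (hnorm T r p) (hardy T r q) (hnorm T r q) (mult_op \<psi>)"
    and "b \<equiv> bounded_op T (hardy0 T r p) (hnorm T r p) (hardy0 T r q) (hnorm T r q) (mult_op \<psi>)"
    and "S \<equiv> (SUP n. ennreal (real (card (level T r n)) powr (1 / p - 1 / q) * mean_inf T r n \<psi>))"
  assumes "rooted_tree T r"
    and "infinite (pverts T)"
    and "\<And>n. finite (level T r n)"
    and "0 < p" and "p < q"
  shows "(a \<longleftrightarrow> b) \<and> (b \<longleftrightarrow> S < \<infinity>) \<and>
    (S < \<infinity> \<longrightarrow>
      op_norm T (hardy T r p) (hnorm T r p) (hnorm T r q) (mult_op \<psi>) = S \<and>
      op_norm T (hardy0 T r p) (hnorm T r p) (hnorm T r q) (mult_op \<psi>) = S)"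
proof -
  interpret finite_levels T r
    using assms(4-6) by unfold_locales (auto dest: rooted_tree.level_nonempty)
  have sub: "hardy0 T r p \<subseteq> hardy T r p"
    by (auto simp: hardy0_def)
  have norms: "op_norm T (hardy T r p) (hnorm T r p) (hnorm T r q) (mult_op \<psi>) = S"
    "op_norm T (hardy0 T r p) (hnorm T r p) (hnorm T r q) (mult_op \<psi>) = S"
    unfolding S_def using sub assms(7,8) by (auto intro: op_norm_mult_op)
  \<comment> \<open>By \<open>norms\<close>, the norm condition in each \<open>bounded_op\<close> is
    finiteness of \<open>S\<close>, which in turn implies the mapping condition.\<close>
  have "a \<longleftrightarrow> S < \<infinity>" "b \<longleftrightarrow> S < \<infinity>"
    unfolding a_def b_def bounded_op_def norms
    using mult_op_hardy mult_op_hardy0 assms(7,8) by (auto simp: S_def)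
  with norms show ?thesis
    by simp
qed

end
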